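(* Let $n\ge 1$ and $\sigma\in S_n$. Write $\sigma=M_1\,w_1\,M_2\,w_2\,\cdots\,M_k\,w_k$, where $M_1<M_2<\cdots<M_k$ are the left-to-right maxima of $\sigma$ (so $M_k=n$) and $w_1,\dots,w_k$ are possibly empty words. Let $l_i$ denote the length of $w_i$. Then: (a) $\sigma\in Av(3214,3241,4213,4231)$ if and only if the renormalization of $w_k$ is a permutation in $Av(231,213)$, and, if $k>1$, the juxtaposition $w_1w_2\cdots w_{k-1}$ consists of the smallest $l_1+\cdots+l_{k-1}$ elements of $[n-1]\setminus\{M_1,\dots,M_{k-1}\}$, listed in increasing order. In particular, in this case the renormalization of $\alpha=M_1\,w_1\,\cdots\,M_{k-1}\,w_{k-1}$ avoids $321$. (b) $\sigma\in Av(3124,3142,4123,4132)$ if and only if the renormalization of $w_k$ is a permutation in $Av(123,132)$, and, if $k>1$, for every $i\le k-1$ the word $w_i$ consists of the $l_i$ greatest symbols that are less than $M_i$ and do not occur in $\sigma$ before $w_i$, listed in decreasing order. In particular, in this case the renormalization of $\alpha=M_1\,w_1\,\cdots\,M_{k-1}\,w_{k-1}$ avoids $312$.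
   Context: A permutation $\sigma$ contains a permutation $\tau$ if some subsequence of $\sigma$ has the same relative order as $\tau$; otherwise $\sigma$ avoids $\tau$. $Av(B)$ is the set of permutations avoiding every pattern in $B$, and $S_n(B)=Av(B)\cap S_n$. An entry $\sigma(i)$ is a left-to-right maximum if $\sigma(i)\ge\sigma(j)$ for all $j\le i$. The renormalization of a word of distinct integers is the permutation with the same relative order. $[m]=\{1,\dots,m\}$. *)

theory Defs
  imports
    "HOL-Library.Sublist"
    "HOL-Combinatorics.Multiset_Permutations"
begin

text \<open>
  Permutations are in one-line notation: \<open>\<sigma> \<in> Perms n\<close> is the list
  \<open>[\<sigma>(1), \<dots>, \<sigma>(n)]\<close>, so that factors, subsequences and juxtapositions of words
  are list operations.
\<close>

abbreviation Perms :: "nat \<Rightarrow> nat list set" where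
  "Perms n \<equiv> permutations_of_set {1..n}"

definition same_rel_order :: "'a::linorder list \<Rightarrow> 'b::linorder list \<Rightarrow> bool" where
  "same_rel_order u v \<longleftrightarrow> length u = length v \<and>
     (\<forall>i<length u. \<forall>j<length u. u ! i < u ! j \<longleftrightarrow> v ! i < v ! j)"

definition contains :: "nat list \<Rightarrow> nat list \<Rightarrow> bool" where
  "contains \<sigma> \<tau> \<longleftrightarrow> (\<exists>u. subseq u \<sigma> \<and> same_rel_order u \<tau>)"

definition avoids :: "nat list \<Rightarrow> nat list \<Rightarrow> bool" where
  "avoids \<sigma> \<tau> \<longleftrightarrow> \<not> contains \<sigma> \<tau>"

definition Av :: "nat list set \<Rightarrow> nat list set" where
  "Av B = {\<sigma>. (\<exists>n. \<sigma> \<in> Perms n) \<and> (\<forall>\<tau>\<in>B. avoids \<sigma> \<tau>)}"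

text \<open>
  The renormalization of a word of distinct letters, given by replacing every letter by its
  rank; \<open>renorm_iff\<close> below states that this is the unique permutation with the same
  relative order.
\<close>

definition renorm :: "'a::linorder list \<Rightarrow> nat list" where
  "renorm w = map (\<lambda>x. card {y \<in> set w. y \<le> x}) w"

definition lr_maxima :: "nat list \<Rightarrow> nat set" where
  "lr_maxima \<sigma> = {\<sigma> ! i | i. i < length \<sigma> \<and> (\<forall>j\<le>i. \<sigma> ! j \<le> \<sigma> ! i)}"

text \<open>
  \<open>blocks M w i j\<close> is the word \<open>M\<^sub>i w\<^sub>i \<dots> M\<^sub>j w\<^sub>j\<close>
  (empty if \<open>j < i\<close>).
\<close>

definition blocks :: "(nat \<Rightarrow> nat) \<Rightarrow> (nat \<Rightarrow> nat list) \<Rightarrow> nat \<Rightarrow> nat \<Rightarrow> nat list" where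
  "blocks M w i j = concat (map (\<lambda>m. M m # w m) [i..<Suc j])"

text \<open>
  The decomposition \<open>\<sigma> = M\<^sub>1 w\<^sub>1 \<dots> M\<^sub>k w\<^sub>k\<close> at the left-to-right maxima
  \<open>M\<^sub>1 < \<dots> < M\<^sub>k\<close>; only the values of \<open>M\<close> and \<open>w\<close> on \<open>{1..k}\<close> are relevant.
\<close>

definition lr_decomp ::
  "nat list \<Rightarrow> nat \<Rightarrow> (nat \<Rightarrow> nat) \<Rightarrow> (nat \<Rightarrow> nat list) \<Rightarrow> bool" where
  "lr_decomp \<sigma> k M w \<longleftrightarrow>
     \<sigma> = blocks M w 1 k \<and> strict_mono_on {1..k} M \<and> M ` {1..k} = lr_maxima \<sigma>"

definition smallest :: "nat \<Rightarrow> nat set \<Rightarrow> nat list" where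
  "smallest m A = take m (sorted_list_of_set A)"

definition greatest :: "nat \<Rightarrow> nat set \<Rightarrow> nat list" where
  "greatest m A = take m (rev (sorted_list_of_set A))"

lemma rank_less_iff:
  assumes "finite A" "x \<in> A" "y \<in> A"
  shows "card {z \<in> A. z \<le> x} < card {z \<in> A. z \<le> y} \<longleftrightarrow> x < (y::'a::linorder)"
proof
  assume "x < y"
  then have "{z \<in> A. z \<le> x} \<subset> {z \<in> A. z \<le> y}"
    using assms by force
  then show "card {z \<in> A. z \<le> x} < card {z \<in> A. z \<le> y}"
    using assms by (intro psubset_card_mono) auto
next
  assume *: "card {z \<in> A. z \<le> x} < card {z \<in> A. z \<le> y}"
  show "x < y"
  proof (rule ccontr)
    assume "\<not> x < y"
    then have "{z \<in> A. z \<le> y} \<subseteq> {z \<in> A. z \<le> x}" by auto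
    then have "card {z \<in> A. z \<le> y} \<le> card {z \<in> A. z \<le> x}"
      using assms by (intro card_mono) auto
    with * show False by simp
  qed
qed

lemma renorm_same_rel_order: "same_rel_order w (renorm w)"
  by (simp add: same_rel_order_def renorm_def rank_less_iff)

lemma renorm_in_Perms:
  assumes "distinct w"
  shows "renorm w \<in> Perms (length w)"
proof -
  let ?r = "\<lambda>x. card {y \<in> set w. y \<le> x}"
  have inj: "inj_on ?r (set w)"
  proof (rule inj_onI)
    fix x y assume "x \<in> set w" "y \<in> set w" "?r x = ?r y"
    then have "\<not> x < y" "\<not> y < x"
      using rank_less_iff[of "set w" x y] rank_less_iff[of "set w" y x] by simp_all
    then show "x = y" by simp
  qed
  have "?r ` set w \<subseteq> {1..length w}"
  proof
    fix m assume "m \<in> ?r ` set w"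
    then obtain x where x: "x \<in> set w" "m = ?r x" by auto
    have "?r x \<le> card (set w)" by (intro card_mono) auto
    moreover have "0 < ?r x" using x by (subst card_gt_0_iff) auto
    ultimately show "m \<in> {1..length w}"
      using x card_length[of w] by (simp add: Suc_le_eq del: card_gt_0_iff)
  qed
  then have "?r ` set w = {1..length w}"
    by (rule card_subset_eq[rotated])
      (simp_all add: card_image[OF inj] distinct_card[OF assms])
  then show ?thesis
    using assms inj by (simp add: permutations_of_set_def renorm_def distinct_map)
qed

lemma Perms_renorm:
  assumes "p \<in> Perms n"
  shows "renorm p = p"
proof -
  have "{y \<in> {1..n}. y \<le> x} = {1..x}" if "x \<in> {1..n}" for x
    using that by auto
  then show ?thesis
    using assms by (auto simp: permutations_of_set_def renorm_def intro!: map_idI)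
qed

lemma renorm_cong:
  assumes "same_rel_order u v" "distinct u" "distinct v"
  shows "renorm u = renorm v"
proof (rule nth_equalityI)
  show "length (renorm u) = length (renorm v)"
    using assms by (simp add: renorm_def same_rel_order_def)
  fix i assume "i < length (renorm u)"
  then have i: "i < length u" by (simp add: renorm_def)
  have len: "length v = length u" using assms by (simp add: same_rel_order_def)
  have *: "card {y \<in> set w. y \<le> w ! i} = card {j. j < length w \<and> w ! j \<le> w ! i}"
    if "distinct w" for w :: "'c::linorder list"
  proof -
    have "{y \<in> set w. y \<le> w ! i} = (!) w ` {j. j < length w \<and> w ! j \<le> w ! i}"
      by (auto simp: in_set_conv_nth)
    moreover have "inj_on ((!) w) {j. j < length w \<and> w ! j \<le> w ! i}"
      using that by (auto simp: inj_on_def nth_eq_iff_index_eq)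
    ultimately show ?thesis by (simp add: card_image)
  qed
  have "{j. j < length u \<and> u ! j \<le> u ! i} = {j. j < length v \<and> v ! j \<le> v ! i}"
    using assms(1) i unfolding same_rel_order_def by (auto simp flip: not_less)
  then show "renorm u ! i = renorm v ! i"
    using i len *[OF assms(2)] *[OF assms(3)] by (simp add: renorm_def)
qed

lemma renorm_iff:
  assumes "distinct w"
  shows "p = renorm w \<longleftrightarrow> (\<exists>n. p \<in> Perms n) \<and> same_rel_order w p"
proof
  assume "p = renorm w"
  then show "(\<exists>n. p \<in> Perms n) \<and> same_rel_order w p"
    using renorm_in_Perms[OF assms] renorm_same_rel_order by blast
next
  assume *: "(\<exists>n. p \<in> Perms n) \<and> same_rel_order w p"
  then have "distinct p" by (auto simp: permutations_of_set_def)
  with * have "renorm w = renorm p" using renorm_cong assms by blast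
  with * show "p = renorm w" using Perms_renorm by metis
qed

lemma lr_maxima_subset: "lr_maxima \<sigma> \<subseteq> set \<sigma>"
  by (auto simp: lr_maxima_def)

lemma lr_maxima_snoc:
  "lr_maxima (xs @ [x]) = lr_maxima xs \<union> (if \<forall>y\<in>set xs. y \<le> x then {x} else {})"
proof -
  let ?P = "\<lambda>\<sigma> i. \<forall>j\<le>i. \<sigma> ! j \<le> \<sigma> ! i"
  have lr: "lr_maxima \<sigma> = (!) \<sigma> ` {i \<in> {..<length \<sigma>}. ?P \<sigma> i}" for \<sigma>
    unfolding lr_maxima_def by blast
  have last: "?P (xs @ [x]) (length xs) \<longleftrightarrow> (\<forall>y\<in>set xs. y \<le> x)"
    by (simp add: all_set_conv_all_nth nth_append le_less all_conj_distrib imp_conjL)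
  have front: "?P (xs @ [x]) i \<longleftrightarrow> ?P xs i" if "i < length xs" for i
    using that by (simp add: nth_append)
  have "{i \<in> {..<length (xs @ [x])}. ?P (xs @ [x]) i} =
      {i \<in> {..<length xs}. ?P xs i} \<union>
      (if \<forall>y\<in>set xs. y \<le> x then {length xs} else {})" (is "_ = ?I \<union> ?J")
  proof (rule set_eqI)
    fix i
    consider "i < length xs" | "i = length xs" | "i > length xs" by linarith
    then show "i \<in> {i \<in> {..<length (xs @ [x])}. ?P (xs @ [x]) i} \<longleftrightarrow> i \<in> ?I \<union> ?J"
    proof cases
      case 1
      then show ?thesis unfolding mem_Collect_eq front[OF 1] Un_iff by simp
    next
      case 2
      then show ?thesis using last by simp
    next
      case 3
      then show ?thesis by simp
    qed
  qed
  then have "lr_maxima (xs @ [x]) = (!) (xs @ [x]) ` ?I \<union> (!) (xs @ [x]) ` ?J"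
    by (simp only: lr image_Un)
  moreover have "(!) (xs @ [x]) ` ?I = lr_maxima xs"
    unfolding lr by (rule image_cong) (auto simp: nth_append)
  ultimately show ?thesis by simp
qed

lemma lr_decomp_exists:
  assumes "distinct \<sigma>"
  shows "\<exists>k M w. lr_decomp \<sigma> k M w"
  using assms
proof (induction \<sigma> rule: rev_induct)
  case Nil
  have "lr_decomp [] 0 (\<lambda>_. 0) (\<lambda>_. [])"
    by (simp add: lr_decomp_def blocks_def lr_maxima_def)
  then show ?case by blast
next
  case (snoc x xs)
  then obtain k M w where d: "lr_decomp xs k M w" by auto
  then have xs: "xs = blocks M w 1 k" and mono: "strict_mono_on {1..k} M"
    and im: "M ` {1..k} = lr_maxima xs"
    by (auto simp: lr_decomp_def)
  have cong: "blocks M' w' 1 j = blocks M w 1 j"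
    if "\<And>i. i \<in> {1..j} \<Longrightarrow> M' i = M i \<and> w' i = w i" for M' w' j
    unfolding blocks_def
    by (rule arg_cong[where f = concat], rule map_cong) (use that in auto)
  show ?case
  proof (cases "\<forall>y\<in>set xs. y \<le> x")
    case True
    let ?M = "M(Suc k := x)" and ?w = "w(Suc k := [])"
    have "xs @ [x] = blocks ?M ?w 1 (Suc k)"
      using cong[of k ?M ?w] xs by (simp add: blocks_def)
    moreover have "strict_mono_on {1..Suc k} ?M"
    proof (rule strict_mono_onI)
      fix r s assume rs: "r \<in> {1..Suc k}" "s \<in> {1..Suc k}" "r < s"
      show "?M r < ?M s"
      proof (cases "s = Suc k")
        case s: True
        have "M r \<in> lr_maxima xs" using rs s im by auto
        then have "M r \<in> set xs" using lr_maxima_subset by auto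
        then have "M r < x" using True snoc.prems by (auto simp: le_less)
        then show ?thesis using rs s by simp
      next
        case False
        then have "r \<in> {1..k}" "s \<in> {1..k}" using rs by auto
        then show ?thesis using strict_mono_onD[OF mono] rs by simp
      qed
    qed
    moreover have "?M ` {1..Suc k} = lr_maxima (xs @ [x])"
    proof -
      have "?M ` {1..k} = M ` {1..k}" by (rule image_cong) auto
      moreover have "{1..Suc k} = insert (Suc k) {1..k}" by auto
      ultimately have "?M ` {1..Suc k} = insert x (lr_maxima xs)"
        using im by (simp only: image_insert fun_upd_same)
      then show ?thesis using True by (simp add: lr_maxima_snoc)
    qed
    ultimately have "lr_decomp (xs @ [x]) (Suc k) ?M ?w" by (simp add: lr_decomp_def)
    then show ?thesis by blast
  next
    case False
    then have "xs \<noteq> []" by auto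
    then obtain k' where k: "k = Suc k'" using xs by (cases k) (auto simp: blocks_def)
    let ?w = "w(k := w k @ [x])"
    have "xs @ [x] = blocks M ?w 1 k"
      using cong[of k' M ?w] xs k by (simp add: blocks_def)
    moreover have "lr_maxima (xs @ [x]) = lr_maxima xs"
      unfolding lr_maxima_snoc if_not_P[OF False] by simp
    ultimately have "lr_decomp (xs @ [x]) k M ?w"
      using mono im unfolding lr_decomp_def by metis
    then show ?thesis by blast
  qed
qed

end

theory Submission
  imports Defs
begin

text \<open>
  In each of the eight patterns, the second letter \<open>b\<close> is preceded by one of the two large
  letters \<open>x\<close>, \<open>y\<close> and followed, in either order, by the other one and by the remaining
  small letter \<open>c\<close>; so an occurrence is a splitting \<open>\<sigma> = us b vs\<close> with \<open>x\<close> in \<open>us\<close> and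
  \<open>c\<close>, \<open>y\<close> in \<open>vs\<close>. If \<open>b\<close> lies in \<open>w\<^sub>k\<close>, one may take \<open>x = n\<close>, which leaves a condition on
  \<open>w\<^sub>k\<close> alone. If \<open>b\<close> lies in \<open>w\<^sub>i\<close> with \<open>i < k\<close>, one may take \<open>x = M\<^sub>i\<close> and \<open>y = n\<close>, so
  that avoidance says that every later letter \<open>c < M\<^sub>i\<close> compares with \<open>b\<close> in the prescribed way.
\<close>

section \<open>Occurrences of patterns as splittings\<close>

text \<open>An occurrence of the pivot \<open>b\<close> cuts \<open>zs\<close> into two independent
  sides; the stretch \<open>vs1\<close> skipped before \<open>b\<close> is absorbed into the left
  one.\<close>

lemma subseq_append_Cons_iff:
  "subseq (xs @ b # ys) zs \<longleftrightarrow> (\<exists>us vs. zs = us @ b # vs \<and> subseq xs us \<and> subseq ys vs)"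
proof
  assume "subseq (xs @ b # ys) zs"
  then obtain us vs where 1: "zs = us @ vs" "subseq xs us" "subseq (b # ys) vs"
    using list_emb_appendD by blast
  then obtain vs1 vs2 where 2: "vs = vs1 @ b # vs2" "subseq ys vs2"
    using list_emb_ConsD by fastforce
  have "zs = (us @ vs1) @ b # vs2" "subseq xs (us @ vs1)"
    using 1 2 by (auto intro: list_emb_append2)
  then show "\<exists>us vs. zs = us @ b # vs \<and> subseq xs us \<and> subseq ys vs"
    using 2 by blast
qed (auto intro!: list_emb_append_mono)

lemma subseq_Cons_pivot:
  "subseq (x # b # ys) zs \<longleftrightarrow> (\<exists>us vs. zs = us @ b # vs \<and> x \<in> set us \<and> subseq ys vs)"
  using subseq_append_Cons_iff[of "[x]" b ys zs] by (simp add: subseq_singleton_left)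

text \<open>Here two patterns that differ by exchanging their last two letters merge: once both
  orders are allowed, only membership remains. With \<open>c = y\<close> a single occurrence in
  \<open>vs\<close> would break the equivalence.\<close>

lemma subseq_pair_either:
  assumes "c \<noteq> y"
  shows "subseq [c, y] vs \<or> subseq [y, c] vs \<longleftrightarrow> c \<in> set vs \<and> y \<in> set vs"
proof -
  have pair: "subseq [a, b] vs \<longleftrightarrow> (\<exists>us ws. vs = us @ b # ws \<and> a \<in> set us)" for a b
    using subseq_Cons_pivot[of a b "[]" vs] by simp
  show ?thesis
  proof
    assume "subseq [c, y] vs \<or> subseq [y, c] vs"
    then show "c \<in> set vs \<and> y \<in> set vs" unfolding pair by fastforce
  next
    assume vs: "c \<in> set vs \<and> y \<in> set vs"
    then obtain us ws where c: "vs = us @ c # ws" by (meson split_list)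
    then consider "y \<in> set us" | "y \<in> set ws" using vs assms by auto
    then show "subseq [c, y] vs \<or> subseq [y, c] vs"
    proof cases
      case 1
      then show ?thesis unfolding pair using c by blast
    next
      case 2
      then obtain ws1 ws2 where "vs = (us @ c # ws1) @ y # ws2"
        using c by (metis split_list append_Cons append_assoc)
      then show ?thesis unfolding pair[of c y] by (metis in_set_conv_decomp)
    qed
  qed
qed

section \<open>Short patterns, renormalization and the configurations around a pivot\<close>

lemma contains3_iff:
  "contains \<sigma> [p, q, r] \<longleftrightarrow>
     (\<exists>a b c. subseq [a, b, c] \<sigma> \<and> same_rel_order [a, b, c] [p, q, r])"
proof -
  have "\<exists>a b c. u = [a, b, c]" if "same_rel_order u [p, q, r]" for u :: "nat list"
    using that by (auto simp: same_rel_order_def length_Suc_conv)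
  then show ?thesis unfolding contains_def by metis
qed

lemma contains4_iff:
  "contains \<sigma> [p, q, r, s] \<longleftrightarrow>
     (\<exists>a b c d. subseq [a, b, c, d] \<sigma> \<and> same_rel_order [a, b, c, d] [p, q, r, s])"
proof -
  have "\<exists>a b c d. u = [a, b, c, d]" if "same_rel_order u [p, q, r, s]" for u :: "nat list"
    using that by (auto simp: same_rel_order_def length_Suc_conv)
  then show ?thesis unfolding contains_def by metis
qed

text \<open>For literal lists the quantifiers over indices expand into a finite conjunction of
  comparisons.\<close>

lemmas same_rel_order_nth = same_rel_order_def All_less_Suc numeral_2_eq_2 numeral_3_eq_3

text \<open>Passing to ranks is strictly increasing on \<open>set u\<close>, so the subsequences of
  \<open>renorm u\<close> are the rank images of those of \<open>u\<close>, with the same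
  comparisons.\<close>

lemma contains_renorm: "contains (renorm u) \<tau> \<longleftrightarrow> contains u \<tau>"
proof -
  let ?f = "\<lambda>x. card {y \<in> set u. y \<le> x}"
  have sub: "subseq v (renorm u) \<longleftrightarrow> (\<exists>v'. v = map ?f v' \<and> subseq v' u)" for v
    by (auto simp: renorm_def subseq_conv_nths nths_map)
  have ord: "same_rel_order (map ?f v) \<tau> \<longleftrightarrow> same_rel_order v \<tau>" if "subseq v u" for v
  proof -
    have "v ! i \<in> set u" if "i < length v" for i
      using \<open>subseq v u\<close> that nth_mem[OF that] by (metis in_set_nthsD subseq_conv_nths)
    then show ?thesis by (auto simp: same_rel_order_def rank_less_iff)
  qed
  show ?thesis unfolding contains_def sub using ord by blast
qed

lemma avoids_renorm: "avoids (renorm u) \<tau> \<longleftrightarrow> avoids u \<tau>"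
  by (simp add: avoids_def contains_renorm)

text \<open>\<open>R\<close> is \<open>>\<close> in (a) and \<open><\<close> in (b). Leaving open
  both the comparison of \<open>x\<close> with \<open>y\<close> and the order of \<open>c\<close>
  and \<open>y\<close> in \<open>vs\<close> makes one configuration stand for four patterns.\<close>

definition occurs_xbcy :: "(nat \<Rightarrow> nat \<Rightarrow> bool) \<Rightarrow> nat list \<Rightarrow> bool" where
  "occurs_xbcy R \<sigma> \<longleftrightarrow> (\<exists>us b vs x c y. \<sigma> = us @ b # vs \<and> x \<in> set us \<and> c \<in> set vs \<and> y \<in> set vs \<and>
     R b c \<and> b < x \<and> c < x \<and> b < y \<and> c < y)"

text \<open>What remains of the configuration when a letter larger than the whole word stands in
  front of it and serves as \<open>x\<close>.\<close>

definition occurs_bcy :: "(nat \<Rightarrow> nat \<Rightarrow> bool) \<Rightarrow> nat list \<Rightarrow> bool" where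
  "occurs_bcy R \<sigma> \<longleftrightarrow> (\<exists>us b vs c y. \<sigma> = us @ b # vs \<and> c \<in> set vs \<and> y \<in> set vs \<and>
     R b c \<and> b < y \<and> c < y)"

text \<open>\<open>Z\<close> is the set of letters occurring after \<open>\<sigma>\<close> in a longer word.\<close>

definition occurs_xbc :: "(nat \<Rightarrow> nat \<Rightarrow> bool) \<Rightarrow> nat list \<Rightarrow> nat set \<Rightarrow> bool" where
  "occurs_xbc R \<sigma> Z \<longleftrightarrow> (\<exists>us b vs x c. \<sigma> = us @ b # vs \<and> x \<in> set us \<and> c \<in> set vs \<union> Z \<and>
     R b c \<and> b < x \<and> c < x)"

text \<open>Distinctness supplies \<open>x \<noteq> y\<close>, as \<open>x\<close> precedes the
  pivot and \<open>y\<close> follows it; this excludes a tie between the two large letters.\<close>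

lemma occurs_xbcy_iff_subseq:
  assumes "distinct \<sigma>"
  shows "occurs_xbcy R \<sigma> \<longleftrightarrow>
    (\<exists>x b c y. (subseq [x, b, c, y] \<sigma> \<or> subseq [x, b, y, c] \<sigma>) \<and> x \<noteq> y \<and>
      R b c \<and> b < x \<and> c < x \<and> b < y \<and> c < y)"
proof
  assume "occurs_xbcy R \<sigma>"
  then obtain us b vs x c y where *: "\<sigma> = us @ b # vs" "x \<in> set us" "c \<in> set vs" "y \<in> set vs"
     "R b c" "b < x" "c < x" "b < y" "c < y"
    unfolding occurs_xbcy_def by blast
  have "x \<noteq> y" using * assms by auto
  moreover have "subseq [c, y] vs \<or> subseq [y, c] vs" using * by (subst subseq_pair_either) auto
  ultimately show "\<exists>x b c y. (subseq [x, b, c, y] \<sigma> \<or> subseq [x, b, y, c] \<sigma>) \<and> x \<noteq> y \<and>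
      R b c \<and> b < x \<and> c < x \<and> b < y \<and> c < y"
    using * unfolding subseq_Cons_pivot[of _ _ "[_, _]"] by blast
next
  assume "\<exists>x b c y. (subseq [x, b, c, y] \<sigma> \<or> subseq [x, b, y, c] \<sigma>) \<and> x \<noteq> y \<and>
      R b c \<and> b < x \<and> c < x \<and> b < y \<and> c < y"
  then obtain x b c y us vs where *: "\<sigma> = us @ b # vs" "x \<in> set us"
     "R b c" "b < x" "c < x" "b < y" "c < y" "subseq [c, y] vs \<or> subseq [y, c] vs"
    unfolding subseq_Cons_pivot[of _ _ "[_, _]"] by blast
  then have "c \<in> set vs \<and> y \<in> set vs" by (subst (asm) subseq_pair_either) auto
  with * show "occurs_xbcy R \<sigma>" unfolding occurs_xbcy_def by blast
qed

lemma occurs_bcy_iff_subseq: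
  "occurs_bcy R \<sigma> \<longleftrightarrow>
    (\<exists>b c y. (subseq [b, c, y] \<sigma> \<or> subseq [b, y, c] \<sigma>) \<and> R b c \<and> b < y \<and> c < y)"
proof -
  have *: "subseq [b, c, y] \<sigma> \<or> subseq [b, y, c] \<sigma> \<longleftrightarrow>
      (\<exists>us vs. \<sigma> = us @ b # vs \<and> c \<in> set vs \<and> y \<in> set vs)" if "c < y" for b c y
    using subseq_append_Cons_iff[of "[]" b "[c, y]" \<sigma>] subseq_append_Cons_iff[of "[]" b "[y, c]" \<sigma>]
      subseq_pair_either[of c y] less_imp_neq[OF that] by simp blast
  show ?thesis unfolding occurs_bcy_def using * by blast
qed

lemma occurs_xbc_iff_subseq:
  "occurs_xbc R \<sigma> {} \<longleftrightarrow>
    (\<exists>x b c. subseq [x, b, c] \<sigma> \<and> R b c \<and> b < x \<and> c < x)"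
  unfolding occurs_xbc_def subseq_Cons_pivot by (auto simp: subseq_singleton_left; blast)

section \<open>The pattern sets of the theorem as configurations\<close>

lemma avoids_a_iff:
  assumes "distinct \<sigma>"
  shows "(\<forall>\<tau>\<in>{[3,2,1,4], [3,2,4,1], [4,2,1,3], [4,2,3,1]}. avoids \<sigma> \<tau>) \<longleftrightarrow> \<not> occurs_xbcy (>) \<sigma>"
proof -
  \<comment> \<open>Letters are named by role: in 3241 and 4231 the smallest letter \<open>c\<close>
    comes last, so patterns that differ by this exchange get the same chain of inequalities.\<close>
  have so: "same_rel_order [a, b, c, d] [3,2,1,4::nat] \<longleftrightarrow> c < b \<and> b < a \<and> a < d"
    "same_rel_order [a, b, d, c] [3,2,4,1::nat] \<longleftrightarrow> c < b \<and> b < a \<and> a < d"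
    "same_rel_order [a, b, c, d] [4,2,1,3::nat] \<longleftrightarrow> c < b \<and> b < d \<and> d < a"
    "same_rel_order [a, b, d, c] [4,2,3,1::nat] \<longleftrightarrow> c < b \<and> b < d \<and> d < a" for a b c d :: nat
    by (auto simp: same_rel_order_nth)
  \<comment> \<open>Which of \<open>x\<close> and \<open>y\<close> is larger separates the pair
    3214, 3241 from the pair 4213, 4231.\<close>
  have ord: "x \<noteq> y \<and> b > c \<and> b < x \<and> c < x \<and> b < y \<and> c < y \<longleftrightarrow>
      (c < b \<and> b < x \<and> x < y) \<or> (c < b \<and> b < y \<and> y < x)" for x b c y :: nat
    by auto
  have "occurs_xbcy (>) \<sigma> \<longleftrightarrow> contains \<sigma> [3,2,1,4] \<or> contains \<sigma> [3,2,4,1] \<or>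
      contains \<sigma> [4,2,1,3] \<or> contains \<sigma> [4,2,3,1]"
    unfolding occurs_xbcy_iff_subseq[OF assms] contains4_iff so ord by blast
  then show ?thesis by (auto simp: avoids_def)
qed

lemma avoids_b_iff:
  assumes "distinct \<sigma>"
  shows "(\<forall>\<tau>\<in>{[3,1,2,4], [3,1,4,2], [4,1,2,3], [4,1,3,2]}. avoids \<sigma> \<tau>) \<longleftrightarrow> \<not> occurs_xbcy (<) \<sigma>"
proof -
  have so: "same_rel_order [a, b, c, d] [3,1,2,4::nat] \<longleftrightarrow> b < c \<and> c < a \<and> a < d"
    "same_rel_order [a, b, d, c] [3,1,4,2::nat] \<longleftrightarrow> b < c \<and> c < a \<and> a < d"
    "same_rel_order [a, b, c, d] [4,1,2,3::nat] \<longleftrightarrow> b < c \<and> c < d \<and> d < a"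
    "same_rel_order [a, b, d, c] [4,1,3,2::nat] \<longleftrightarrow> b < c \<and> c < d \<and> d < a" for a b c d :: nat
    by (auto simp: same_rel_order_nth)
  have ord: "x \<noteq> y \<and> b < c \<and> b < x \<and> c < x \<and> b < y \<and> c < y \<longleftrightarrow>
      (b < c \<and> c < x \<and> x < y) \<or> (b < c \<and> c < y \<and> y < x)" for x b c y :: nat
    by auto
  have "occurs_xbcy (<) \<sigma> \<longleftrightarrow> contains \<sigma> [3,1,2,4] \<or> contains \<sigma> [3,1,4,2] \<or>
      contains \<sigma> [4,1,2,3] \<or> contains \<sigma> [4,1,3,2]"
    unfolding occurs_xbcy_iff_subseq[OF assms] contains4_iff so ord by blast
  then show ?thesis by (auto simp: avoids_def)
qed

lemma avoids_231_213_iff: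
  "(\<forall>\<tau>\<in>{[2,3,1], [2,1,3]}. avoids \<sigma> \<tau>) \<longleftrightarrow> \<not> occurs_bcy (>) \<sigma>"
proof -
  have so: "same_rel_order [b, d, c] [2,3,1::nat] \<longleftrightarrow> c < b \<and> b < d"
    "same_rel_order [b, c, d] [2,1,3::nat] \<longleftrightarrow> c < b \<and> b < d" for b c d :: nat
    by (auto simp: same_rel_order_nth)
  have ord: "b > c \<and> b < y \<and> c < y \<longleftrightarrow> c < b \<and> b < y" for b c y :: nat
    by auto
  have "occurs_bcy (>) \<sigma> \<longleftrightarrow> contains \<sigma> [2,3,1] \<or> contains \<sigma> [2,1,3]"
    unfolding occurs_bcy_iff_subseq contains3_iff so ord by blast
  then show ?thesis by (auto simp: avoids_def)
qed

lemma avoids_123_132_iff: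
  "(\<forall>\<tau>\<in>{[1,2,3], [1,3,2]}. avoids \<sigma> \<tau>) \<longleftrightarrow> \<not> occurs_bcy (<) \<sigma>"
proof -
  have so: "same_rel_order [b, d, c] [1,3,2::nat] \<longleftrightarrow> b < c \<and> c < d"
    "same_rel_order [b, c, d] [1,2,3::nat] \<longleftrightarrow> b < c \<and> c < d" for b c d :: nat
    by (auto simp: same_rel_order_nth)
  have ord: "b < c \<and> b < y \<and> c < y \<longleftrightarrow> b < c \<and> c < y" for b c y :: nat
    by auto
  have "occurs_bcy (<) \<sigma> \<longleftrightarrow> contains \<sigma> [1,2,3] \<or> contains \<sigma> [1,3,2]"
    unfolding occurs_bcy_iff_subseq contains3_iff so ord by blast
  then show ?thesis by (auto simp: avoids_def)
qed

lemma avoids_321_iff: "avoids \<sigma> [3,2,1] \<longleftrightarrow> \<not> occurs_xbc (>) \<sigma> {}"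
proof -
  have so: "same_rel_order [a, b, c] [3,2,1::nat] \<longleftrightarrow> c < b \<and> b < a" for a b c :: nat
    by (auto simp: same_rel_order_nth)
  have ord: "b > c \<and> b < x \<and> c < x \<longleftrightarrow> c < b \<and> b < x" for x b c :: nat
    by auto
  show ?thesis unfolding avoids_def occurs_xbc_iff_subseq contains3_iff so ord by blast
qed

lemma avoids_312_iff: "avoids \<sigma> [3,1,2] \<longleftrightarrow> \<not> occurs_xbc (<) \<sigma> {}"
proof -
  have so: "same_rel_order [a, b, c] [3,1,2::nat] \<longleftrightarrow> b < c \<and> c < a" for a b c :: nat
    by (auto simp: same_rel_order_nth)
  have ord: "b < c \<and> b < x \<and> c < x \<longleftrightarrow> b < c \<and> c < x" for x b c :: nat
    by auto
  show ?thesis unfolding avoids_def occurs_xbc_iff_subseq contains3_iff so ord by blast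
qed

section \<open>Membership in \<open>Av\<close> and the cut at the largest letter\<close>

lemma Av_iff_avoids: "\<sigma> \<in> Perms n \<Longrightarrow> \<sigma> \<in> Av B \<longleftrightarrow> (\<forall>\<tau>\<in>B. avoids \<sigma> \<tau>)"
  unfolding Av_def by blast

lemma renorm_Av_iff_avoids: "distinct u \<Longrightarrow> renorm u \<in> Av B \<longleftrightarrow> (\<forall>\<tau>\<in>B. avoids u \<tau>)"
  using Av_iff_avoids[OF renorm_in_Perms, of u B] by (simp add: avoids_renorm)

text \<open>If the pivot lies in \<open>\<alpha>\<close>, the letter \<open>N\<close> stands after
  it and can serve as \<open>y\<close>; if it lies in \<open>v\<close>, \<open>N\<close> stands
  before it and can serve as \<open>x\<close>. In both cases the comparisons with \<open>N\<close>
  hold automatically.\<close>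

lemma occurs_xbcy_append_Cons:
  assumes "\<And>z. z \<in> set \<alpha> \<union> set v \<Longrightarrow> z < N"
  shows "occurs_xbcy R (\<alpha> @ N # v) \<longleftrightarrow> occurs_xbc R \<alpha> (set v) \<or> occurs_bcy R v"
proof
  assume "occurs_xbcy R (\<alpha> @ N # v)"
  then obtain us b vs x c y where *: "\<alpha> @ N # v = us @ b # vs" "x \<in> set us" "c \<in> set vs"
     "y \<in> set vs" "R b c" "b < x" "c < x" "b < y" "c < y"
    unfolding occurs_xbcy_def by blast
  \<comment> \<open>Both lie strictly below \<open>x\<close>, and every letter is at most
    \<open>N\<close>.\<close>
  have "b \<noteq> N" "c \<noteq> N"
  proof -
    have "set us \<subseteq> set (\<alpha> @ N # v)" unfolding *(1) by auto
    then have "x \<le> N" using assms *(2) by (auto dest: less_imp_le)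
    then show "b \<noteq> N" "c \<noteq> N" using * by auto
  qed
  with *(1) consider zs where "\<alpha> = us @ b # zs" "vs = zs @ N # v"
    | zs where "v = zs @ b # vs"
    by (auto simp: append_eq_append_conv2 Cons_eq_append_conv append_eq_Cons_conv)
  then show "occurs_xbc R \<alpha> (set v) \<or> occurs_bcy R v"
  proof cases
    case 1
    then have "c \<in> set zs \<union> set v" using *(3) \<open>c \<noteq> N\<close> by auto
    then have "occurs_xbc R \<alpha> (set v)"
      using 1(1) * unfolding occurs_xbc_def by blast
    then show ?thesis ..
  next
    case 2
    then have "occurs_bcy R v"
      using * unfolding occurs_bcy_def by blast
    then show ?thesis ..
  qed
next
  assume "occurs_xbc R \<alpha> (set v) \<or> occurs_bcy R v"
  then show "occurs_xbcy R (\<alpha> @ N # v)"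
  proof
    assume "occurs_xbc R \<alpha> (set v)"
    then obtain us b vs x c where *: "\<alpha> = us @ b # vs" "x \<in> set us" "c \<in> set vs \<union> set v"
      "R b c" "b < x" "c < x"
      unfolding occurs_xbc_def by blast
    have "\<alpha> @ N # v = us @ b # (vs @ N # v)" "c \<in> set (vs @ N # v)" "N \<in> set (vs @ N # v)"
      "b < N" "c < N"
      using * assms by auto
    then show ?thesis using * unfolding occurs_xbcy_def by blast
  next
    assume "occurs_bcy R v"
    then obtain us b vs c y where *: "v = us @ b # vs" "c \<in> set vs" "y \<in> set vs"
      "R b c" "b < y" "c < y"
      unfolding occurs_bcy_def by blast
    have "\<alpha> @ N # v = (\<alpha> @ N # us) @ b # vs" "N \<in> set (\<alpha> @ N # us)" "b < N" "c < N"
      using * assms by auto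
    then show ?thesis using * unfolding occurs_xbcy_def by blast
  qed
qed

text \<open>An occurrence of 321 or 312 within \<open>\<alpha>\<close> is the case
  \<open>Z = {}\<close>; this yields the two claims introduced by "in particular".\<close>

lemma occurs_xbc_mono: "occurs_xbc R \<alpha> {} \<Longrightarrow> occurs_xbc R \<alpha> Z"
  unfolding occurs_xbc_def by blast

section \<open>Prefixes of sorted lists\<close>

lemma sorted_wrt_iff_split:
  "sorted_wrt P xs \<longleftrightarrow> (\<forall>us b vs. xs = us @ b # vs \<longrightarrow> (\<forall>c\<in>set vs. P b c))"
  by (induction xs) (auto simp: Cons_eq_append_conv)

text \<open>Only letters at different positions are compared, and these are distinct; so a negated
  strict order may be exchanged for the reversed strict order.\<close>

lemma sorted_wrt_cong_distinct:
  assumes "distinct xs"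
    and "\<And>b c. b \<in> set xs \<Longrightarrow> c \<in> set xs \<Longrightarrow> b \<noteq> c \<Longrightarrow> P b c = Q b c"
  shows "sorted_wrt P xs = sorted_wrt Q xs"
  using assms by (auto simp: sorted_wrt_iff_nth_less nth_eq_iff_index_eq)

text \<open>Applied to \<open>xs = w i\<close> with \<open>E\<close> the later letters: the partner
  \<open>c\<close> of the pivot lies either further right in the same word, which is a matter of
  sortedness, or in \<open>E\<close>.\<close>

lemma no_split_iff_sorted_wrt:
  "\<not> (\<exists>p b q. xs = p @ b # q \<and> (\<exists>c \<in> set q \<union> E. T b c)) \<longleftrightarrow>
     sorted_wrt (\<lambda>b c. \<not> T b c) xs \<and> (\<forall>b\<in>set xs. \<forall>c\<in>E. \<not> T b c)"
  unfolding sorted_wrt_iff_split by (auto simp: in_set_conv_decomp)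

text \<open>For \<open>c < m\<close> in \<open>E\<close>, disjointness excludes
  \<open>c = b\<close>, so \<open>c < b\<close> is the negation of \<open>b < c\<close>. Serves (b)
  with \<open>m = M i\<close>.\<close>

lemma below_iff_not_between:
  fixes m :: "'a::linorder"
  assumes "\<And>b. b \<in> W \<Longrightarrow> b < m" "W \<inter> {c \<in> E. c < m} = {}"
  shows "(\<forall>b\<in>W. \<forall>c\<in>{c \<in> E. c < m}. c < b) \<longleftrightarrow> (\<forall>b\<in>W. \<forall>c\<in>E. \<not> (b < c \<and> c < m))"
  using assms by (fastforce simp: not_less le_less)

lemma sorted_wrt_concat:
  "sorted_wrt P (concat xss) \<longleftrightarrow> (\<forall>xs\<in>set xss. sorted_wrt P xs) \<and>
     sorted_wrt (\<lambda>xs ys. \<forall>x\<in>set xs. \<forall>y\<in>set ys. P x y) xss"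
  by (induction xss) (auto simp: sorted_wrt_append)

lemma sorted_wrt_upt_iff:
  "sorted_wrt P [a..<b] \<longleftrightarrow> (\<forall>i\<in>{a..<b}. \<forall>j\<in>{i<..<b}. P i j)"
  by (induction b) (auto simp: sorted_wrt_append less_Suc_eq Ball_def)

text \<open>A strictly sorted list is determined by its set, so the sorted list of \<open>A\<close>
  is \<open>C\<close> followed by the sorted list of \<open>E\<close> exactly when that
  concatenation is increasing.\<close>

lemma smallest_iff:
  assumes "finite E" "A = set C \<union> E" "set C \<inter> E = {}" "distinct C"
  shows "C = smallest (length C) A \<longleftrightarrow> sorted_wrt (<) C \<and> (\<forall>b\<in>set C. \<forall>c\<in>E. b < c)"
proof
  assume "C = smallest (length C) A"
  then obtain D where D: "sorted_list_of_set A = C @ D"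
    unfolding smallest_def by (metis append_take_drop_id)
  have "set (C @ D) = set C \<union> E" unfolding D[symmetric] using assms by simp
  then have "E \<subseteq> set D" using assms(3) by auto
  moreover have "sorted_wrt (<) (C @ D)" unfolding D[symmetric] by (simp add: sorted_wrt_rev)
  ultimately show "sorted_wrt (<) C \<and> (\<forall>b\<in>set C. \<forall>c\<in>E. b < c)"
    by (auto simp: sorted_wrt_append)
next
  assume "sorted_wrt (<) C \<and> (\<forall>b\<in>set C. \<forall>c\<in>E. b < c)"
  then have "sorted_wrt (<) (C @ sorted_list_of_set E)"
    using assms by (simp add: sorted_wrt_append)
  then have "C @ sorted_list_of_set E = sorted_list_of_set A"
    using assms by (intro strict_sorted_equal) auto
  then show "C = smallest (length C) A" unfolding smallest_def by (metis append_eq_conv_conj)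
qed

text \<open>The mirror image of the argument for \<open>smallest\<close>: \<open>rev C\<close> has
  to close the increasing list of \<open>A\<close>.\<close>

lemma greatest_iff:
  assumes "finite E" "A = set C \<union> E" "set C \<inter> E = {}" "distinct C"
  shows "C = greatest (length C) A \<longleftrightarrow> sorted_wrt (>) C \<and> (\<forall>b\<in>set C. \<forall>c\<in>E. c < b)"
proof
  assume "C = greatest (length C) A"
  then obtain D where D: "rev (sorted_list_of_set A) = C @ D"
    unfolding greatest_def by (metis append_take_drop_id)
  have "set (C @ D) = set C \<union> E" unfolding D[symmetric] using assms by simp
  then have "E \<subseteq> set D" using assms(3) by auto
  moreover have "sorted_wrt (>) (C @ D)" unfolding D[symmetric] by (simp add: sorted_wrt_rev)
  ultimately show "sorted_wrt (>) C \<and> (\<forall>b\<in>set C. \<forall>c\<in>E. c < b)"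
    by (auto simp: sorted_wrt_append)
next
  assume "sorted_wrt (>) C \<and> (\<forall>b\<in>set C. \<forall>c\<in>E. c < b)"
  then have "sorted_wrt (<) (sorted_list_of_set E @ rev C)"
    using assms by (simp add: sorted_wrt_append sorted_wrt_rev)
  then have "sorted_list_of_set E @ rev C = sorted_list_of_set A"
    using assms by (intro strict_sorted_equal) auto
  then have "rev (sorted_list_of_set A) = C @ rev (sorted_list_of_set E)"
    by (metis rev_append rev_rev_ident)
  then show "C = greatest (length C) A" unfolding greatest_def by simp
qed

section \<open>The decomposition at the left-to-right maxima\<close>

text \<open>Because \<open>1 \<le> i\<close>, the truncated \<open>i - 1\<close> is the true
  predecessor; for \<open>i = 1\<close> the first factor is empty.\<close>

lemma blocks_split:
  assumes "1 \<le> i" "i \<le> k"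
  shows "blocks M w 1 k = blocks M w 1 (i - 1) @ M i # w i @ blocks M w (Suc i) k"
proof -
  have "[1..<Suc k] = [1..<Suc (i - 1)] @ i # [Suc i..<Suc k]"
    using assms upt_add_eq_append[of 1 i "Suc k - i"] by (simp add: upt_conv_Cons)
  then show ?thesis unfolding blocks_def by simp
qed

lemma set_blocks: "set (blocks M w i j) = (\<Union>m\<in>{i..j}. insert (M m) (set (w m)))"
  by (simp add: blocks_def atLeastLessThanSuc_atLeastAtMost del: upt_Suc)

lemma prefix_max_in_lr_maxima:
  assumes "\<sigma> = us @ vs" "m \<in> set us" "\<And>y. y \<in> set us \<Longrightarrow> y \<le> m"
  shows "m \<in> lr_maxima \<sigma>"
proof -
  obtain i where "i < length us" "us ! i = m" using assms(2) by (auto simp: in_set_conv_nth)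
  then show ?thesis using assms unfolding lr_maxima_def
    by (auto simp: nth_append intro!: exI[of _ i])
qed

text \<open>\<open>lr_decomp\<close> fixes the set of left-to-right maxima, not their positions. The
  maximum of the prefix is a left-to-right maximum, hence some \<open>M j\<close>; distinctness
  rules out \<open>j > i\<close>, and monotonicity of \<open>M\<close> gives the bound.\<close>

lemma lr_decomp_le:
  assumes "lr_decomp \<sigma> k M w" "distinct \<sigma>" "1 \<le> i" "i \<le> k" "z \<in> set (blocks M w 1 i)"
  shows "z \<le> M i"
proof -
  let ?S = "set (blocks M w 1 i)"
  have \<sigma>: "\<sigma> = blocks M w 1 k" and mono: "strict_mono_on {1..k} M"
    and lr: "M ` {1..k} = lr_maxima \<sigma>"
    using assms(1) by (auto simp: lr_decomp_def)
  have split: "\<sigma> = blocks M w 1 i @ blocks M w (Suc i) k"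
    using blocks_split[of i k M w] blocks_split[of i i M w] assms \<sigma> by (simp add: blocks_def)
  have "Max ?S \<in> ?S" using assms(5) by (intro Max_in) auto
  then have "Max ?S \<in> lr_maxima \<sigma>"
    using prefix_max_in_lr_maxima[OF split] by simp
  then obtain j where j: "j \<in> {1..k}" "Max ?S = M j" using lr by (metis imageE)
  have "j \<le> i"
  proof (rule ccontr)
    assume "\<not> j \<le> i"
    then have "M j \<in> set (blocks M w (Suc i) k)" using j by (auto simp: set_blocks)
    then show False using split \<open>distinct \<sigma>\<close> \<open>Max ?S \<in> ?S\<close> j by auto
  qed
  then have "M j \<le> M i"
    using strict_mono_onD[OF mono, of j i] j assms by (cases "j = i") auto
  then show ?thesis using j assms(5) by (metis List.finite_set Max_ge order_trans)
qed

text \<open>The bound for prefixes, applied to the whole word and its letter \<open>n\<close>, gives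
  \<open>n \<le> M k\<close>.\<close>

lemma lr_decomp_last:
  assumes "lr_decomp \<sigma> k M w" "\<sigma> \<in> Perms n" "n \<ge> 1"
  shows "1 \<le> k" "M k = n"
proof -
  have \<sigma>: "\<sigma> = blocks M w 1 k" "set \<sigma> = {1..n}" "distinct \<sigma>"
    using assms by (auto simp: lr_decomp_def permutations_of_set_def)
  show k: "1 \<le> k" using \<sigma> assms(3) by (cases k) (auto simp: blocks_def)
  have "n \<le> M k" using lr_decomp_le[OF assms(1) \<sigma>(3) k, of n] \<sigma> assms(3) by simp
  moreover have "M k \<in> set \<sigma>" unfolding \<sigma>(1) using k by (auto simp: set_blocks)
  then have "M k \<le> n" unfolding \<sigma>(2) by simp
  ultimately show "M k = n" by simp
qed

text \<open>In the prefix ending with \<open>w i\<close> no letter exceeds \<open>M i\<close>, so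
  any \<open>x\<close> before a pivot in \<open>w i\<close> may be replaced by \<open>M i\<close>.
  The pivot cannot itself be some \<open>M i\<close>, as no earlier letter is larger.\<close>

lemma occurs_xbc_blocks:
  assumes d: "lr_decomp \<sigma> k M w" and "distinct \<sigma>" "1 \<le> k"
  shows "occurs_xbc R (blocks M w 1 (k - 1)) (set (w k)) \<longleftrightarrow>
    (\<exists>i\<in>{1..k-1}. \<exists>p b q. w i = p @ b # q \<and>
       (\<exists>c \<in> set q \<union> (set (blocks M w (Suc i) (k - 1)) \<union> set (w k)). R b c \<and> c < M i))"
proof -
  let ?\<alpha> = "blocks M w 1 (k - 1)"
  have \<sigma>: "\<sigma> = ?\<alpha> @ M k # w k"
    using d blocks_split[of k k M w] \<open>1 \<le> k\<close> by (simp add: lr_decomp_def blocks_def)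
  then have dist: "distinct ?\<alpha>" using \<open>distinct \<sigma>\<close> by simp
  have \<alpha>: "?\<alpha> = blocks M w 1 (i - 1) @ M i # w i @ blocks M w (Suc i) (k - 1)"
    if "i \<in> {1..k-1}" for i
    using blocks_split[of i "k - 1" M w] that by simp
  have le: "z \<le> M i" if "i \<in> {1..k-1}" "z \<in> set (blocks M w 1 i)" for i z
    using lr_decomp_le[OF d \<open>distinct \<sigma>\<close>, of i z] that by auto
  have bi: "blocks M w 1 i = blocks M w 1 (i - 1) @ M i # w i" if "i \<in> {1..k-1}" for i
    using blocks_split[of i i M w] that by (simp add: blocks_def)
  show ?thesis
  proof
    assume "occurs_xbc R ?\<alpha> (set (w k))"
    then obtain us b vs x c where *: "?\<alpha> = us @ b # vs" "x \<in> set us" "c \<in> set vs \<union> set (w k)"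
      "R b c" "b < x" "c < x"
      unfolding occurs_xbc_def by blast
    have "b \<in> set ?\<alpha>" using * by simp
    then obtain i where i: "i \<in> {1..k-1}" and b: "b = M i \<or> b \<in> set (w i)"
      by (auto simp: set_blocks)
    from b show "\<exists>i\<in>{1..k-1}. \<exists>p b q. w i = p @ b # q \<and>
       (\<exists>c \<in> set q \<union> (set (blocks M w (Suc i) (k - 1)) \<union> set (w k)). R b c \<and> c < M i)"
    proof
      assume "b = M i"
      \<comment> \<open>As \<open>b\<close> occurs only once, both factorizations at
        \<open>b\<close> coincide; then \<open>x \<le> M i = b\<close>, against
        \<open>b < x\<close>.\<close>
      have "M i \<notin> set (blocks M w 1 (i - 1))" "M i \<notin> set (w i @ blocks M w (Suc i) (k - 1))"
        using \<alpha>[OF i] dist by auto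
      then have "us = blocks M w 1 (i - 1)"
        using \<alpha>[OF i] *(1) \<open>b = M i\<close> append_Cons_eq_iff by metis
      then have "x \<le> M i" using le[OF i, of x] bi[OF i] *(2) by simp
      then show ?thesis using * \<open>b = M i\<close> by simp
    next
      assume "b \<in> set (w i)"
      then obtain p q where w: "w i = p @ b # q" by (auto simp: in_set_conv_decomp)
      let ?us = "blocks M w 1 (i - 1) @ M i # p" and ?vs = "q @ blocks M w (Suc i) (k - 1)"
      have eq: "?\<alpha> = ?us @ b # ?vs" using \<alpha>[OF i] w by simp
      then have "b \<notin> set ?us" "b \<notin> set ?vs" using dist by auto
      then have "us = ?us" "vs = ?vs"
        using eq *(1) by (metis append_Cons_eq_iff)+
      then have "x \<le> M i" using le[OF i, of x] bi[OF i] *(2) w by auto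
      then have "c < M i" "c \<in> set q \<union> (set (blocks M w (Suc i) (k - 1)) \<union> set (w k))"
        using * \<open>vs = ?vs\<close> by auto
      then show ?thesis using i w *(4) by blast
    qed
  next
    assume "\<exists>i\<in>{1..k-1}. \<exists>p b q. w i = p @ b # q \<and>
       (\<exists>c \<in> set q \<union> (set (blocks M w (Suc i) (k - 1)) \<union> set (w k)). R b c \<and> c < M i)"
    then obtain i p b q c where *: "i \<in> {1..k-1}" "w i = p @ b # q"
      "c \<in> set q \<union> (set (blocks M w (Suc i) (k - 1)) \<union> set (w k))" "R b c" "c < M i"
      by blast
    let ?us = "blocks M w 1 (i - 1) @ M i # p" and ?vs = "q @ blocks M w (Suc i) (k - 1)"
    have eq: "?\<alpha> = ?us @ b # ?vs" using \<alpha>[OF *(1)] *(2) by simp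
    have "b \<le> M i" using le[OF *(1), of b] bi[OF *(1)] *(2) by simp
    moreover have "b \<noteq> M i" using eq dist by auto
    ultimately have "b < M i" by simp
    \<comment> \<open>\<open>M i\<close> takes the role of \<open>x\<close>.\<close>
    moreover have "M i \<in> set ?us" "c \<in> set ?vs \<union> set (w k)" using * by auto
    ultimately show "occurs_xbc R ?\<alpha> (set (w k))"
      using eq *(4,5) unfolding occurs_xbc_def by blast
  qed
qed

section \<open>The two characterizations\<close>

theorem theorem1:
  fixes n k :: nat and \<sigma> :: "nat list" and M :: "nat \<Rightarrow> nat" and w :: "nat \<Rightarrow> nat list"
  assumes "n \<ge> 1" and "\<sigma> \<in> Perms n" and "lr_decomp \<sigma> k M w"
  shows
    "M k = n \<and>
     (\<sigma> \<in> Av {[3,2,1,4], [3,2,4,1], [4,2,1,3], [4,2,3,1]} \<longleftrightarrow>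
       renorm (w k) \<in> Av {[2,3,1], [2,1,3]} \<and>
       (k > 1 \<longrightarrow>
          concat (map w [1..<k]) =
            smallest (\<Sum>i=1..k-1. length (w i)) ({1..n-1} - M ` {1..k-1}))) \<and>
     (\<sigma> \<in> Av {[3,2,1,4], [3,2,4,1], [4,2,1,3], [4,2,3,1]} \<longrightarrow>
       avoids (renorm (blocks M w 1 (k-1))) [3,2,1]) \<and>
     (\<sigma> \<in> Av {[3,1,2,4], [3,1,4,2], [4,1,2,3], [4,1,3,2]} \<longleftrightarrow>
       renorm (w k) \<in> Av {[1,2,3], [1,3,2]} \<and>
       (k > 1 \<longrightarrow>
          (\<forall>i\<in>{1..k-1}. w i =
             greatest (length (w i))
               {x \<in> {1..n}. x < M i \<and> x \<notin> set (blocks M w 1 (i-1) @ [M i])}))) \<and>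
     (\<sigma> \<in> Av {[3,1,2,4], [3,1,4,2], [4,1,2,3], [4,1,3,2]} \<longrightarrow>
       avoids (renorm (blocks M w 1 (k-1))) [3,1,2])"
proof -
  let ?\<alpha> = "blocks M w 1 (k - 1)"
  \<comment> \<open>For \<open>i < k\<close> these are the letters after \<open>w i\<close> except
    \<open>n\<close>, which exceeds \<open>M i\<close> and so can never be a
    \<open>c\<close>.\<close>
  let ?later = "\<lambda>i. set (blocks M w (Suc i) (k - 1)) \<union> set (w k)"
  note d = assms(3)
  have set\<sigma>: "set \<sigma> = {1..n}" and dist: "distinct \<sigma>"
    using assms(2) by (auto simp: permutations_of_set_def)
  have k: "1 \<le> k" and Mk: "M k = n" using lr_decomp_last[OF d assms(2,1)] by auto
  have mono: "strict_mono_on {1..k} M" using d by (simp add: lr_decomp_def)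
  have \<sigma>: "\<sigma> = ?\<alpha> @ n # w k"
    using d blocks_split[of k k M w] k Mk by (simp add: lr_decomp_def blocks_def)
  have \<alpha>: "?\<alpha> = blocks M w 1 (i - 1) @ M i # w i @ blocks M w (Suc i) (k - 1)"
    if "i \<in> {1..k-1}" for i
    using blocks_split[of i "k - 1" M w] that by simp
  have lt_n: "z < n" if "z \<in> set ?\<alpha> \<union> set (w k)" for z
  proof -
    have "z \<in> set \<sigma>" "z \<noteq> n" using that \<sigma> dist by auto
    then show ?thesis using set\<sigma> by simp
  qed
  have w_lt: "b < M i" if "i \<in> {1..k-1}" "b \<in> set (w i)" for i b
  proof -
    have "b \<le> M i"
      using that by (intro lr_decomp_le[OF d dist]) (auto simp: set_blocks)
    moreover have "b \<noteq> M i" using \<alpha>[OF that(1)] \<sigma> dist that(2) by auto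
    ultimately show ?thesis by simp
  qed
  have M_lt: "M i < M j" if "i \<in> {1..k-1}" "i < j" "j \<le> k" for i j
    using strict_mono_onD[OF mono, of i j] that by auto
  have distw: "distinct (w k)" using \<sigma> dist by simp
  \<comment> \<open>The cut at \<open>n\<close>: the first disjunct concerns
    \<open>?\<alpha>\<close>, the second is the pattern condition on \<open>w k\<close>.\<close>
  have occ: "occurs_xbcy R \<sigma> \<longleftrightarrow> occurs_xbc R ?\<alpha> (set (w k)) \<or> occurs_bcy R (w k)" for R
    using occurs_xbcy_append_Cons[OF lt_n, where R = R] \<sigma> by simp
  note prefix = occurs_xbc_blocks[OF d dist k]
  \<comment> \<open>For \<open>k = 1\<close> the range \<open>{1..k-1}\<close> is empty, which
    matches the guard \<open>k > 1\<close> in the statement.\<close>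
  have triv: "\<not> occurs_xbc R ?\<alpha> (set (w k))" if "\<not> k > 1" for R
    unfolding prefix using that by simp

  have A: "\<not> occurs_xbc (>) ?\<alpha> (set (w k)) \<longleftrightarrow> (k > 1 \<longrightarrow>
      concat (map w [1..<k]) =
        smallest (\<Sum>i=1..k-1. length (w i)) ({1..n-1} - M ` {1..k-1}))" (is "_ \<longleftrightarrow> (_ \<longrightarrow> ?sm)")
  proof -
    let ?C = "concat (map w [1..<k])"
    have X: "{1..k-1} = {1..<k}" by auto
    have setC: "set ?C = (\<Union>i\<in>{1..k-1}. set (w i))" unfolding X by simp
    have "subseq (concat (map w xs)) (concat (map (\<lambda>m. M m # w m) xs))" for xs
      by (induction xs) (auto intro: list_emb_append_mono subseq_Cons')
    then have "subseq ?C ?\<alpha>" using k by (simp add: blocks_def)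
    \<comment> \<open>\<open>?C\<close> arises from \<open>?\<alpha>\<close> by deleting the maxima,
      so it inherits distinctness.\<close>
    then have distC: "distinct ?C" using \<sigma> dist by (auto simp: subseq_conv_nths distinct_nthsI)
    have "set ?\<alpha> = M ` {1..k-1} \<union> set ?C" unfolding setC set_blocks by auto
    moreover have "{1..n-1} = set ?\<alpha> \<union> set (w k)"
    proof -
      have "{1..n-1} = set \<sigma> - {n}" unfolding set\<sigma> by auto
      also have "\<dots> = set ?\<alpha> \<union> set (w k)" using lt_n by (subst \<sigma>) auto
      finally show ?thesis .
    qed
    \<comment> \<open>No maximum recurs inside a word, so removing the maxima from
      \<open>{1..n-1}\<close> leaves exactly the letters of the words.\<close>
    moreover have "M ` {1..k-1} \<inter> (set ?C \<union> set (w k)) = {}"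
    proof -
      have "M i \<notin> set (w j)" if i: "i \<in> {1..k-1}" and j: "j \<in> {1..k}" for i j
      proof
        assume *: "M i \<in> set (w j)"
        consider "j < i" | "j = i" | "i < j" "j \<le> k - 1" | "j = k" using j by force
        then show False
        proof cases
          case 1
          then have "j \<in> {1..k-1}" "i \<le> k" using i j by auto
          then show False using w_lt[OF _ *] M_lt[of j i] 1 by force
        next
          case 2
          then show False using w_lt[OF i] * by force
        next
          case 3
          then have "M i \<in> set (blocks M w (Suc i) (k - 1))" using * by (auto simp: set_blocks)
          then show False using \<alpha>[OF i] \<sigma> dist by simp
        next
          case 4
          then show False using \<alpha>[OF i] \<sigma> dist * by simp
        qed
      qed
      then have "M i \<notin> set ?C \<union> set (w k)" if "i \<in> {1..k-1}" for i
        using that k unfolding setC by auto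
      then show ?thesis by blast
    qed
    \<comment> \<open>This brings the set into the form of \<open>smallest_iff\<close>, with
      \<open>E = set (w k)\<close>.\<close>
    ultimately have un: "{1..n-1} - M ` {1..k-1} = set ?C \<union> set (w k)" by auto
    have disj: "set ?C \<inter> set (w k) = {}"
      using \<sigma> dist setC by (auto simp: set_blocks)
    have len: "length ?C = (\<Sum>i=1..k-1. length (w i))"
      unfolding X by (simp add: length_concat comp_def sum_list_distinct_conv_sum_set)
    have "?sm \<longleftrightarrow> sorted_wrt (<) ?C \<and> (\<forall>b\<in>set ?C. \<forall>c\<in>set (w k). b < c)"
      using smallest_iff[OF finite_set un disj distC] len by simp
    also have "sorted_wrt (<) ?C \<longleftrightarrow> (\<forall>i\<in>{1..<k}. sorted_wrt (<) (w i)) \<and>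
        (\<forall>i\<in>{1..<k}. \<forall>j\<in>{i<..<k}. \<forall>b\<in>set (w i). \<forall>c\<in>set (w j). b < c)"
      unfolding sorted_wrt_concat sorted_wrt_map sorted_wrt_upt_iff by simp
    \<comment> \<open>Sortedness of the juxtaposition is regrouped into one condition per
      \<open>i\<close>, to be matched with the avoidance criterion word by word.\<close>
    finally have sm: "?sm \<longleftrightarrow> (\<forall>i\<in>{1..<k}. sorted_wrt (<) (w i) \<and>
        (\<forall>b\<in>set (w i). \<forall>c\<in>(\<Union>j\<in>{i<..<k}. set (w j)) \<union> set (w k). b < c))"
      unfolding setC X by blast
    \<comment> \<open>Since \<open>b < M i\<close>, a letter \<open>c < b\<close> also satisfies
      \<open>c < M i\<close>; so avoidance says that all letters of \<open>?later i\<close>, and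
      those after \<open>b\<close> in \<open>w i\<close>, exceed \<open>b\<close>.\<close>
    have "\<not> (\<exists>p b q. w i = p @ b # q \<and> (\<exists>c \<in> set q \<union> ?later i. c < b \<and> c < M i)) \<longleftrightarrow>
        sorted_wrt (<) (w i) \<and>
        (\<forall>b\<in>set (w i). \<forall>c\<in>(\<Union>j\<in>{i<..<k}. set (w j)) \<union> set (w k). b < c)"
      if i: "i \<in> {1..k-1}" for i
    proof -
      have disj_i: "set (w i) \<inter> ?later i = {}" and "distinct (w i)"
        using \<alpha>[OF i] \<sigma> dist by auto
      then have "sorted_wrt (\<lambda>b c. \<not> (c < b \<and> c < M i)) (w i) \<longleftrightarrow> sorted_wrt (<) (w i)"
        using w_lt[OF i] by (intro sorted_wrt_cong_distinct) auto
      moreover have "(\<forall>c\<in>?later i. \<not> (c < b \<and> c < M i)) \<longleftrightarrow>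
          (\<forall>c\<in>(\<Union>j\<in>{i<..<k}. set (w j)) \<union> set (w k). b < c)" if b: "b \<in> set (w i)" for b
      proof -
        have later: "\<not> (c < b \<and> c < M i) \<longleftrightarrow> b < c" if "c \<in> ?later i" for c
          using b that disj_i w_lt[OF i b] by (cases "b = c") auto
        have "(\<forall>c\<in>?later i. \<not> (c < b \<and> c < M i)) \<longleftrightarrow> (\<forall>c\<in>?later i. b < c)"
          by (rule ball_cong[OF refl later])
        also have "\<dots> \<longleftrightarrow> (\<forall>c\<in>(\<Union>j\<in>{i<..<k}. set (w j)) \<union> set (w k). b < c)"
        proof -
          have Y: "{Suc i..k-1} = {i<..<k}" by auto
          \<comment> \<open>The maxima among the later letters drop out, since
            \<open>b < M i < M j\<close>.\<close>
          have "b < M j" if "j \<in> {i<..<k}" for j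
            using w_lt[OF i b] M_lt[OF i, of j] that by simp
          then show ?thesis unfolding set_blocks Y ball_Un ball_UN by simp
        qed
        finally show ?thesis .
      qed
      ultimately show ?thesis unfolding no_split_iff_sorted_wrt by (simp only: cong: ball_cong)
    qed
    then have "\<not> occurs_xbc (>) ?\<alpha> (set (w k)) \<longleftrightarrow> ?sm"
      unfolding prefix sm X[symmetric] bex_simps(8) by (intro ball_cong refl)
    then show ?thesis using triv by blast
  qed

  have B: "\<not> occurs_xbc (<) ?\<alpha> (set (w k)) \<longleftrightarrow> (k > 1 \<longrightarrow> (\<forall>i\<in>{1..k-1}. w i =
      greatest (length (w i)) {x \<in> {1..n}. x < M i \<and> x \<notin> set (blocks M w 1 (i-1) @ [M i])}))"
  proof -
    have "w i = greatest (length (w i))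
         {x \<in> {1..n}. x < M i \<and> x \<notin> set (blocks M w 1 (i-1) @ [M i])} \<longleftrightarrow>
       \<not> (\<exists>p b q. w i = p @ b # q \<and> (\<exists>c \<in> set q \<union> ?later i. b < c \<and> c < M i))"
      (is "?g \<longleftrightarrow> ?r") if i: "i \<in> {1..k-1}" for i
    proof -
      \<comment> \<open>The candidates for \<open>greatest\<close> are the letters of
        \<open>w i\<close> together with \<open>?E\<close>; \<open>n\<close> is not among them
        because \<open>M i < n\<close>.\<close>
      let ?E = "{c \<in> ?later i. c < M i}"
      have s: "\<sigma> = blocks M w 1 (i - 1) @ M i # w i @ blocks M w (Suc i) (k - 1) @ n # w k"
        using \<sigma> \<alpha>[OF i] by simp
      have "M i < n" using M_lt[OF i, of k] Mk i by auto
      then have "{x \<in> {1..n}. x < M i \<and> x \<notin> set (blocks M w 1 (i-1) @ [M i])} = set (w i) \<union> ?E"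
        using w_lt[OF i] dist unfolding set\<sigma>[symmetric] unfolding s by auto
      moreover have disj_i: "set (w i) \<inter> ?E = {}" and "distinct (w i)"
        using dist unfolding s by auto
      ultimately have "?g \<longleftrightarrow> sorted_wrt (>) (w i) \<and> (\<forall>b\<in>set (w i). \<forall>c\<in>?E. c < b)"
        by (intro greatest_iff) auto
      \<comment> \<open>Inside \<open>w i\<close> every \<open>c\<close> is below
        \<open>M i\<close>, and distinctness turns \<open>\<not> b < c\<close> into
        \<open>c < b\<close>.\<close>
      also have "sorted_wrt (>) (w i) \<longleftrightarrow> sorted_wrt (\<lambda>b c. \<not> (b < c \<and> c < M i)) (w i)"
        using w_lt[OF i] \<open>distinct (w i)\<close> by (intro sorted_wrt_cong_distinct) auto
      also have "(\<forall>b\<in>set (w i). \<forall>c\<in>?E. c < b) \<longleftrightarrow>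
          (\<forall>b\<in>set (w i). \<forall>c\<in>?later i. \<not> (b < c \<and> c < M i))"
        using w_lt[OF i] disj_i by (intro below_iff_not_between)
      finally have "?g \<longleftrightarrow> sorted_wrt (\<lambda>b c. \<not> (b < c \<and> c < M i)) (w i) \<and>
          (\<forall>b\<in>set (w i). \<forall>c\<in>?later i. \<not> (b < c \<and> c < M i))" .
      also have "\<dots> \<longleftrightarrow> ?r" unfolding no_split_iff_sorted_wrt by (rule refl)
      finally show ?thesis .
    qed
    then have "\<not> occurs_xbc (<) ?\<alpha> (set (w k)) \<longleftrightarrow> (\<forall>i\<in>{1..k-1}. w i =
      greatest (length (w i)) {x \<in> {1..n}. x < M i \<and> x \<notin> set (blocks M w 1 (i-1) @ [M i])})"
      unfolding prefix bex_simps(8) by (intro ball_cong refl) (rule sym)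
    then show ?thesis using triv by blast
  qed

  \<comment> \<open>After these rewrites every clause besides \<open>M k = n\<close> is
    propositional in the configurations; the claims on \<open>?\<alpha>\<close> alone follow by
    monotonicity in \<open>Z\<close>.\<close>
  show ?thesis
    unfolding Av_iff_avoids[OF assms(2)] renorm_Av_iff_avoids[OF distw]
      avoids_a_iff[OF dist] avoids_b_iff[OF dist] avoids_231_213_iff avoids_123_132_iff
      A[symmetric] B[symmetric] occ avoids_renorm
    unfolding avoids_321_iff avoids_312_iff
    using Mk occurs_xbc_mono[of "(>)" ?\<alpha> "set (w k)"] occurs_xbc_mono[of "(<)" ?\<alpha> "set (w k)"]
    by auto
qed

end
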